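(* Let $D\ge 3$, let $f$ and $g$ be the metric functions of the static spherically symmetric spacetime $ds^2=-f(r)dt^2+g(r)dr^2+r^2d\Omega_{D-2}^2$ with $0<f,g<\infty$, and let $\mu\neq 0$, $\omega\in\mathbb{R}$. Consider the accretion problem $F(r,n)=\mathrm{const}$, where $$F(r,n)=h(n)^2\left[f(r)+\frac{\mu^2}{r^{2(D-2)}n^2}\right]\frac{1}{1-\omega^2 f(r)r^{-2}},$$ for a fluid of ideal photon gas, i.e. $h(n)=K n^{1/(D-1)}$ with a constant $K>0$. Then for every physical transonic accretion flow of this problem, its sonic point(s) must be on (one of) the unstable photon sphere(s) of the spacetime; that is, the radius of each sonic point of the flow is the radius of an unstable photon sphere.
   Context: Setting. $f,g$ are positive functions of $r>0$ on the radial interval considered, with $f$ twice continuously differentiable; $d\Omega_{D-2}^2$ is the unit round $(D-2)$-sphere metric. The enthalpy per particle is $h(n)>0$, $n>0$ being the number density. The equation $F(r,n)=\mathrm{const}$ describes a stationary, rotating, geometrically thin disk on the equatorial plane; $\mu$ is the particle flux constant and $\omega$ the (constant) ratio of angular momentum flux to energy flux. The phase space is the set of $(r,n)$ with $r$ in the radial interval, $n>0$ and $1-\omega^2 f(r)r^{-2}>0$. Flows. A physical accretion flow is a differentiable single-valued function $n=n(r)>0$ on an open interval of radii, with graph in the phase space, along which $F(r,n(r))$ is constant. Sonic points. The squared sound speed is $v_s^2(n)=\dfrac{d\ln h}{d\ln n}$ (so $v_s^2=1/(D-1)$ for ideal photon gas). The squared 3-velocity of the fluid, in the frame co-rotating with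 the fluid at fixed radius, is $v^2=\dfrac{\mu^2}{\mu^2+f(r)r^{2(D-2)}n^2}$. A sonic point is a phase-space point with $v^2=v_s^2$. A flow is transonic if it experiences a transition between a subsonic state ($v^2<v_s^2$) and a supersonic state ($v^2>v_s^2$); a sonic point of the flow is a point of its graph where such a transition occurs, i.e. $v^2-v_s^2$ vanishes there and has opposite signs on the two sides nearby. Photon spheres. A photon sphere is a sphere $r=r_0$ on which null geodesics can take circular orbits; equivalently $(fr^{-2})'(r_0)=0$. It is stable (resp. unstable), meaning these circular orbits are stable (resp. unstable), if and only if $(fr^{-2})''(r_0)>0$ (resp. $<0$). Primes denote $d/dr$.
   Formalization: Unstable means that the circular null orbits are unstable; the criterion (f/r²)''<0 is concluded only where (f/r²)'' is nonzero, since it fails at degenerate photon spheres (D=3, ω=0, f=r²(1−(r−1)⁶)); g is assumed differentiable so that the geodesic equation makes sense. *)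

theory Defs
  imports "HOL-Analysis.Analysis"
begin

text \<open>
  The metric is \<open>- f dt\<^sup>2 + g dr\<^sup>2 + r\<^sup>2 d\<Omega>\<^sup>2\<close>.  Differentiability of \<open>g\<close> is what is needed to
  write down the geodesic equation.
\<close>

definition static_spherical_metric :: "real set \<Rightarrow> (real \<Rightarrow> real) \<Rightarrow> (real \<Rightarrow> real) \<Rightarrow> bool" where
  "static_spherical_metric I f g \<longleftrightarrow>
     open I \<and> is_interval I \<and> I \<subseteq> {0<..} \<and>
     (\<forall>r\<in>I. f r > 0 \<and> g r > 0) \<and>
     (\<forall>r\<in>I. f differentiable at r \<and> deriv f differentiable at r) \<and>
     continuous_on I (deriv (deriv f)) \<and>
     (\<forall>r\<in>I. g differentiable at r)"

section \<open>Null geodesics and photon spheres\<close>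

text \<open>
  By spherical symmetry every geodesic lies in a plane through the centre, which is taken to be the
  equatorial one, so a geodesic is given by \<open>t\<close>, \<open>r\<close> and one angle \<open>\<phi>\<close> (lifted to the reals) as
  functions of an affine parameter.  The last four clauses are the null condition and the three
  components of the geodesic equation, the latter multiplied by \<open>f\<close>, \<open>g\<close> and \<open>r\<close> respectively.
  For a null vector, being nonzero is the same as having a nonzero \<open>t\<close>-component.
\<close>

definition null_geodesic ::
  "real set \<Rightarrow> (real \<Rightarrow> real) \<Rightarrow> (real \<Rightarrow> real) \<Rightarrow> real set \<Rightarrow>
   (real \<Rightarrow> real) \<Rightarrow> (real \<Rightarrow> real) \<Rightarrow> (real \<Rightarrow> real) \<Rightarrow> bool" where
  "null_geodesic I f g S t r \<phi> \<longleftrightarrow>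
     open S \<and> is_interval S \<and>
     (\<forall>s\<in>S. r s \<in> I \<and>
        t differentiable at s \<and> deriv t differentiable at s \<and>
        r differentiable at s \<and> deriv r differentiable at s \<and>
        \<phi> differentiable at s \<and> deriv \<phi> differentiable at s \<and>
        deriv t s \<noteq> 0 \<and>
        - f (r s) * (deriv t s)\<^sup>2 + g (r s) * (deriv r s)\<^sup>2 + (r s)\<^sup>2 * (deriv \<phi> s)\<^sup>2 = 0 \<and>
        f (r s) * deriv (deriv t) s + deriv f (r s) * deriv r s * deriv t s = 0 \<and>
        g (r s) * deriv (deriv r) s + deriv g (r s) / 2 * (deriv r s)\<^sup>2
          + deriv f (r s) / 2 * (deriv t s)\<^sup>2 - r s * (deriv \<phi> s)\<^sup>2 = 0 \<and>
        r s * deriv (deriv \<phi>) s + 2 * deriv r s * deriv \<phi> s = 0)"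

definition circular_null_orbit ::
  "real set \<Rightarrow> (real \<Rightarrow> real) \<Rightarrow> (real \<Rightarrow> real) \<Rightarrow> real \<Rightarrow> (real \<Rightarrow> real) \<Rightarrow> (real \<Rightarrow> real) \<Rightarrow> bool" where
  "circular_null_orbit I f g r0 t \<phi> \<longleftrightarrow> null_geodesic I f g UNIV t (\<lambda>_. r0) \<phi>"

text \<open>
  Stability of a circular orbit is Lyapunov stability of its radius against perturbation of the
  initial position and velocity, among null geodesics.  Perturbations of the initial values of
  \<open>t\<close> and \<open>\<phi>\<close> themselves are irrelevant by symmetry.
\<close>

definition stable_circular_orbit ::
  "real set \<Rightarrow> (real \<Rightarrow> real) \<Rightarrow> (real \<Rightarrow> real) \<Rightarrow> real \<Rightarrow> (real \<Rightarrow> real) \<Rightarrow> (real \<Rightarrow> real) \<Rightarrow> bool" where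
  "stable_circular_orbit I f g r0 t0 \<phi>0 \<longleftrightarrow>
     (\<forall>\<epsilon>>0. \<exists>\<delta>>0. \<forall>S t r \<phi>.
        null_geodesic I f g S t r \<phi> \<and> 0 \<in> S \<and>
        \<bar>r 0 - r0\<bar> < \<delta> \<and> \<bar>deriv r 0\<bar> < \<delta> \<and>
        \<bar>deriv t 0 - deriv t0 0\<bar> < \<delta> \<and> \<bar>deriv \<phi> 0 - deriv \<phi>0 0\<bar> < \<delta> \<longrightarrow>
        (\<forall>s\<in>S. 0 \<le> s \<longrightarrow> \<bar>r s - r0\<bar> < \<epsilon>))"

definition photon_sphere :: "real set \<Rightarrow> (real \<Rightarrow> real) \<Rightarrow> (real \<Rightarrow> real) \<Rightarrow> real \<Rightarrow> bool" where
  "photon_sphere I f g r0 \<longleftrightarrow> (\<exists>t \<phi>. circular_null_orbit I f g r0 t \<phi>)"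

definition unstable_photon_sphere :: "real set \<Rightarrow> (real \<Rightarrow> real) \<Rightarrow> (real \<Rightarrow> real) \<Rightarrow> real \<Rightarrow> bool" where
  "unstable_photon_sphere I f g r0 \<longleftrightarrow>
     photon_sphere I f g r0 \<and>
     (\<forall>t \<phi>. circular_null_orbit I f g r0 t \<phi> \<longrightarrow> \<not> stable_circular_orbit I f g r0 t \<phi>)"

text \<open>
  The effective potential of null geodesics: with \<open>E = f t'\<close> and \<open>L = r\<^sup>2 \<phi>'\<close> conserved, the null
  condition reads \<open>f g r'\<^sup>2 + (f / r\<^sup>2) L\<^sup>2 = E\<^sup>2\<close>.  Circular orbits sit at its critical points; a
  positive second derivative there means stability and a negative one instability, while a vanishing
  second derivative decides nothing.
\<close>

definition null_potential :: "(real \<Rightarrow> real) \<Rightarrow> real \<Rightarrow> real" where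
  "null_potential f r = f r / r\<^sup>2"

lemma photon_sphere_iff:
  assumes "static_spherical_metric I f g" and r0: "r0 \<in> I"
  shows "photon_sphere I f g r0 \<longleftrightarrow> deriv (null_potential f) r0 = 0"
proof -
  have pos: "r0 > 0" "f r0 > 0" and df: "f differentiable at r0"
    using assms by (auto simp: static_spherical_metric_def)
  have "(f has_field_derivative deriv f r0) (at r0)"
    using df by (metis DERIV_deriv_iff_real_differentiable)
  then have "((\<lambda>r. f r / r\<^sup>2) has_field_derivative
      (deriv f r0 * r0\<^sup>2 - f r0 * (2 * r0)) / (r0\<^sup>2 * r0\<^sup>2)) (at r0)"
    using pos by (auto intro!: derivative_eq_intros)
  then have "deriv (null_potential f) r0 = (deriv f r0 * r0\<^sup>2 - f r0 * (2 * r0)) / (r0\<^sup>2 * r0\<^sup>2)"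
    unfolding null_potential_def [abs_def] by (rule DERIV_imp_deriv)
  then have iff: "deriv (null_potential f) r0 = 0 \<longleftrightarrow> deriv f r0 * r0 = 2 * f r0"
    using pos by (simp add: power2_eq_square algebra_simps)
  show ?thesis
  proof
    assume "photon_sphere I f g r0"
    then obtain t \<phi> where "null_geodesic I f g UNIV t (\<lambda>_. r0) \<phi>"
      by (auto simp: photon_sphere_def circular_null_orbit_def)
    then have "deriv t 0 \<noteq> 0" and n: "f r0 * (deriv t 0)\<^sup>2 = r0\<^sup>2 * (deriv \<phi> 0)\<^sup>2"
      and e: "deriv f r0 / 2 * (deriv t 0)\<^sup>2 = r0 * (deriv \<phi> 0)\<^sup>2"
      by (auto simp: null_geodesic_def)
    have "deriv f r0 * r0 * (deriv t 0)\<^sup>2 = 2 * r0 * (deriv f r0 / 2 * (deriv t 0)\<^sup>2)" by simp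
    also have "\<dots> = 2 * f r0 * (deriv t 0)\<^sup>2"
      unfolding e using n by (simp add: power2_eq_square)
    finally show "deriv (null_potential f) r0 = 0"
      using \<open>deriv t 0 \<noteq> 0\<close> iff by simp
  next
    assume "deriv (null_potential f) r0 = 0"
    then have e: "deriv f r0 * r0 = 2 * f r0" using iff by simp
    define w where "w = sqrt (f r0) / r0"
    have w: "w\<^sup>2 = f r0 / r0\<^sup>2" using pos by (simp add: w_def power_divide)
    have d: "deriv (\<lambda>s::real. s) = (\<lambda>_. 1)" "deriv (\<lambda>s. w * s) = (\<lambda>_. w)"
      by (auto intro!: ext DERIV_imp_deriv derivative_eq_intros)
    have "deriv f r0 = 2 * f r0 / r0" using pos e by (simp add: field_simps)
    then have "r0\<^sup>2 * w\<^sup>2 = f r0" "deriv f r0 / 2 = r0 * w\<^sup>2"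
      unfolding w using pos by (simp_all add: power2_eq_square)
    then have "null_geodesic I f g UNIV (\<lambda>s. s) (\<lambda>_. r0) (\<lambda>s. w * s)"
      using r0 by (simp add: null_geodesic_def d)
    then show "photon_sphere I f g r0"
      by (auto simp: photon_sphere_def circular_null_orbit_def)
  qed
qed

lemma stable_circular_orbit_if:
  assumes m: "static_spherical_metric I f g" and r0: "r0 \<in> I"
    and orb: "circular_null_orbit I f g r0 t0 \<phi>0"
    and d2: "deriv (deriv (null_potential f)) r0 > 0"
  shows "stable_circular_orbit I f g r0 t0 \<phi>0"
  unfolding stable_circular_orbit_def
proof (intro allI impI)
  fix \<epsilon> :: real assume "\<epsilon> > 0"
  let ?x = "null_potential f"
  have I: "open I" and pos: "\<And>r. r \<in> I \<Longrightarrow> r > 0 \<and> f r > 0 \<and> g r > 0"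
    using m by (auto simp: static_spherical_metric_def)
  have fd: "(f has_field_derivative deriv f r) (at r)"
       "(deriv f has_field_derivative deriv (deriv f) r) (at r)" if "r \<in> I" for r
    using m that by (auto simp: static_spherical_metric_def DERIV_deriv_iff_real_differentiable)
  define x1 where "x1 r = (deriv f r * r\<^sup>2 - f r * (2 * r)) / (r\<^sup>2 * r\<^sup>2)" for r
  have x1: "(?x has_field_derivative x1 r) (at r)" if "r \<in> I" for r
    unfolding null_potential_def [abs_def] x1_def
    using pos [OF that] fd [OF that] by (auto intro!: derivative_eq_intros)
  have x1_eq: "deriv ?x r = x1 r" if "r \<in> I" for r
    using x1 [OF that] by (rule DERIV_imp_deriv)
  have "x1 field_differentiable at r0"
    unfolding x1_def [abs_def] field_differentiable_def
    using pos [OF r0] fd [OF r0] by (intro exI) (auto intro!: derivative_eq_intros)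
  then have "(x1 has_field_derivative deriv x1 r0) (at r0)"
    by (simp add: field_differentiable_derivI)
  moreover have "deriv (deriv ?x) r0 = deriv x1 r0"
    by (intro deriv_cong_ev eventually_mono [OF eventually_nhds_in_open [OF I r0]] x1_eq refl)
  ultimately have x2: "(x1 has_field_derivative deriv x1 r0) (at r0)" "deriv x1 r0 > 0"
    using d2 by simp_all
  have "photon_sphere I f g r0" using orb by (auto simp: photon_sphere_def)
  then have x10: "x1 r0 = 0" using photon_sphere_iff [OF m r0] x1_eq [OF r0] by simp
  obtain a where a: "a > 0" "\<And>h. h > 0 \<Longrightarrow> h < a \<Longrightarrow> x1 r0 < x1 (r0 + h)"
    using DERIV_pos_inc_right [OF x2] by blast
  obtain b where b: "b > 0" "\<And>h. h > 0 \<Longrightarrow> h < b \<Longrightarrow> x1 (r0 - h) < x1 r0"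
    using DERIV_pos_inc_left [OF x2] by blast
  obtain k where k: "k > 0" "cball r0 k \<subseteq> I"
    using I r0 open_contains_cball by blast
  define e where "e = min (min \<epsilon> k) (min a b) / 2"
  have e: "e > 0" "e < \<epsilon>" "e < k" "e < a" "e < b"
    using \<open>\<epsilon> > 0\<close> k a b by (auto simp: e_def min_def)
  have inI: "r \<in> I" if "\<bar>r - r0\<bar> \<le> e" for r
    using k e that by (auto simp: dist_real_def abs_minus_commute subset_iff)
  obtain z where z: "r0 < z" "z < r0 + e" "?x (r0 + e) - ?x r0 = (r0 + e - r0) * x1 z"
    using MVT2 [of r0 "r0 + e" ?x x1] x1 inI e by force
  then have "x1 z > 0" using a(2) [of "z - r0"] x10 e by simp
  then have right: "?x (r0 + e) > ?x r0" using z(3) e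
    by (metis add_diff_cancel_left' diff_gt_0_iff_gt mult_pos_pos)
  obtain y where y: "r0 - e < y" "y < r0" "?x r0 - ?x (r0 - e) = (r0 - (r0 - e)) * x1 y"
    using MVT2 [of "r0 - e" r0 ?x x1] x1 inI e by force
  then have "x1 y < 0" using b(2) [of "r0 - y"] x10 e by simp
  then have "e * x1 y < 0" using e by (simp add: mult_pos_neg)
  then have left: "?x (r0 - e) > ?x r0" using y(3) by simp
  define c where "c = min (?x (r0 + e)) (?x (r0 - e))"
  have c: "c > ?x r0" "c \<le> ?x (r0 + e)" "c \<le> ?x (r0 - e)" using left right by (auto simp: c_def)
  define H where "H = (\<lambda>(u, p, q). (f u * p)\<^sup>2 - c * (u\<^sup>2 * q)\<^sup>2)"
  have "deriv t0 0 \<noteq> 0" and nul: "f r0 * (deriv t0 0)\<^sup>2 = r0\<^sup>2 * (deriv \<phi>0 0)\<^sup>2"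
    using orb by (auto simp: null_geodesic_def circular_null_orbit_def)
  then have q: "deriv \<phi>0 0 \<noteq> 0" using pos [OF r0] by auto
  have "(f r0 * deriv t0 0)\<^sup>2 = f r0 * (f r0 * (deriv t0 0)\<^sup>2)"
    by (simp add: power2_eq_square)
  also have "\<dots> = ?x r0 * (r0\<^sup>2 * deriv \<phi>0 0)\<^sup>2"
    unfolding nul using pos [OF r0] by (simp add: null_potential_def power2_eq_square)
  also have "\<dots> < c * (r0\<^sup>2 * deriv \<phi>0 0)\<^sup>2"
    using c q pos [OF r0] by (intro mult_strict_right_mono) auto
  finally have H0: "H (r0, deriv t0 0, deriv \<phi>0 0) < 0" by (simp add: H_def)
  have "isCont f r0" using fd(1) [OF r0] by (rule DERIV_isCont)
  then have "isCont (\<lambda>v. f (fst v)) (r0, deriv t0 0, deriv \<phi>0 0)"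
    by (intro isCont_o2 [of _ fst f]) (auto intro: continuous_intros)
  then have "isCont H (r0, deriv t0 0, deriv \<phi>0 0)"
    unfolding H_def case_prod_beta by (intro continuous_intros)
  then obtain d where d: "d > 0" "\<And>v. dist v (r0, deriv t0 0, deriv \<phi>0 0) < d \<Longrightarrow>
      dist (H v) (H (r0, deriv t0 0, deriv \<phi>0 0)) < - H (r0, deriv t0 0, deriv \<phi>0 0)"
    using H0 unfolding continuous_at_eps_delta by (metis neg_0_less_iff_less)
  have Hneg: "H (u, p, q) < 0"
    if "\<bar>u - r0\<bar> < d / 3" "\<bar>p - deriv t0 0\<bar> < d / 3" "\<bar>q - deriv \<phi>0 0\<bar> < d / 3" for u p q
  proof -
    have "dist (u, p, q) (r0, deriv t0 0, deriv \<phi>0 0)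
        \<le> dist u r0 + (dist p (deriv t0 0) + dist q (deriv \<phi>0 0))"
      unfolding dist_Pair_Pair
      by (rule order_trans [OF sqrt_sum_squares_le_sum]) 
         (auto intro!: sqrt_sum_squares_le_sum)
    also have "\<dots> < d" using that by (simp add: dist_real_def)
    finally show ?thesis using d(2) [of "(u, p, q)"] by (auto simp: dist_real_def abs_if split: if_splits)
  qed
  show "\<exists>\<delta>>0. \<forall>S t r \<phi>.
        null_geodesic I f g S t r \<phi> \<and> 0 \<in> S \<and>
        \<bar>r 0 - r0\<bar> < \<delta> \<and> \<bar>deriv r 0\<bar> < \<delta> \<and>
        \<bar>deriv t 0 - deriv t0 0\<bar> < \<delta> \<and> \<bar>deriv \<phi> 0 - deriv \<phi>0 0\<bar> < \<delta> \<longrightarrow>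
        (\<forall>s\<in>S. 0 \<le> s \<longrightarrow> \<bar>r s - r0\<bar> < \<epsilon>)"
  proof (intro exI [of _ "min e (d / 3)"] conjI allI impI ballI)
    show "min e (d / 3) > 0" using e d by simp
    fix S t r \<phi> s
    assume A: "null_geodesic I f g S t r \<phi> \<and> 0 \<in> S \<and>
        \<bar>r 0 - r0\<bar> < min e (d / 3) \<and> \<bar>deriv r 0\<bar> < min e (d / 3) \<and>
        \<bar>deriv t 0 - deriv t0 0\<bar> < min e (d / 3) \<and> \<bar>deriv \<phi> 0 - deriv \<phi>0 0\<bar> < min e (d / 3)"
      and s: "s \<in> S" "0 \<le> s"
    then have geo: "null_geodesic I f g S t r \<phi>" and S0: "0 \<in> S" by auto
    have S: "convex S" using geo by (auto simp: null_geodesic_def is_interval_convex)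
    have rI: "r s \<in> I" if "s \<in> S" for s using geo that by (auto simp: null_geodesic_def)
    have der: "(t has_field_derivative deriv t s) (at s)"
        "(deriv t has_field_derivative deriv (deriv t) s) (at s)"
        "(r has_field_derivative deriv r s) (at s)"
        "(\<phi> has_field_derivative deriv \<phi> s) (at s)"
        "(deriv \<phi> has_field_derivative deriv (deriv \<phi>) s) (at s)" if "s \<in> S" for s
      using geo that by (auto simp: null_geodesic_def DERIV_deriv_iff_real_differentiable)
    have fr: "((\<lambda>s. f (r s)) has_field_derivative deriv f (r s) * deriv r s) (at s)"
      if "s \<in> S" for s
      using DERIV_chain2 [OF fd(1) [OF rI [OF that]] der(3) [OF that]] .
    define E where "E s = f (r s) * deriv t s" for s
    define L where "L s = (r s)\<^sup>2 * deriv \<phi> s" for s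
    have "(E has_field_derivative 0) (at s)" if "s \<in> S" for s
    proof -
      have "f (r s) * deriv (deriv t) s + deriv f (r s) * deriv r s * deriv t s = 0"
        using geo that by (auto simp: null_geodesic_def)
      then show ?thesis unfolding E_def [abs_def]
        by (auto intro!: derivative_eq_intros fr der that simp: algebra_simps)
    qed
    then have E: "E s = E 0" if "s \<in> S" for s
      using has_field_derivative_zero_constant [OF S, of E] that S0
      by (metis has_field_derivative_at_within)
    have "(L has_field_derivative 0) (at s)" if "s \<in> S" for s
    proof -
      have "r s * (r s * deriv (deriv \<phi>) s + 2 * deriv r s * deriv \<phi> s) = 0"
        using geo that by (auto simp: null_geodesic_def)
      then show ?thesis unfolding L_def [abs_def]
        by (auto intro!: derivative_eq_intros der that simp: algebra_simps power2_eq_square)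
    qed
    then have L: "L s = L 0" if "s \<in> S" for s
      using has_field_derivative_zero_constant [OF S, of L] that S0
      by (metis has_field_derivative_at_within)
    have "H (r 0, deriv t 0, deriv \<phi> 0) < 0" using A by (intro Hneg) auto
    then have HL: "(E 0)\<^sup>2 < c * (L 0)\<^sup>2" by (simp add: H_def E_def L_def)
    have bound: "?x (r s) < c" if "s \<in> S" for s
    proof -
      have P: "r s > 0" "f (r s) > 0" "g (r s) > 0" using pos [OF rI [OF that]] by auto
      have "- f (r s) * (deriv t s)\<^sup>2 + g (r s) * (deriv r s)\<^sup>2 + (r s)\<^sup>2 * (deriv \<phi> s)\<^sup>2 = 0"
        using geo that by (auto simp: null_geodesic_def)
      moreover have "g (r s) * (deriv r s)\<^sup>2 \<ge> 0" using P by simp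
      ultimately have "(r s)\<^sup>2 * (deriv \<phi> s)\<^sup>2 \<le> f (r s) * (deriv t s)\<^sup>2" by linarith
      then have "f (r s) * ((r s)\<^sup>2 * (deriv \<phi> s)\<^sup>2) \<le> f (r s) * (f (r s) * (deriv t s)\<^sup>2)"
        using P by simp
      moreover have "?x (r s) * (L s)\<^sup>2 = f (r s) * ((r s)\<^sup>2 * (deriv \<phi> s)\<^sup>2)"
        using P by (simp add: L_def null_potential_def power2_eq_square)
      moreover have "(E s)\<^sup>2 = f (r s) * (f (r s) * (deriv t s)\<^sup>2)"
        by (simp add: E_def power2_eq_square)
      ultimately have "?x (r s) * (L 0)\<^sup>2 < c * (L 0)\<^sup>2"
        using HL E [OF that] L [OF that] by simp
      then show ?thesis by (simp add: mult_less_cancel_right)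
    qed
    have "\<bar>r s - r0\<bar> < e"
    proof (rule ccontr)
      assume far: "\<not> \<bar>r s - r0\<bar> < e"
      have near: "\<bar>r 0 - r0\<bar> \<le> e" using A by simp
      have "is_interval S" using geo by (simp add: null_geodesic_def)
      then have sub: "u \<in> S" if "0 \<le> u" "u \<le> s" for u
        using S0 s(1) that unfolding is_interval_1 by blast
      have "isCont r u" if "u \<in> {0..s}" for u
        using der(3) [OF sub] that DERIV_isCont by force
      then have "continuous_on {0..s} (\<lambda>u. \<bar>r u - r0\<bar>)"
        by (intro continuous_intros continuous_at_imp_continuous_on ballI)
      then obtain u where "0 \<le> u" "u \<le> s" "\<bar>r u - r0\<bar> = e"
        using IVT' [of "\<lambda>u. \<bar>r u - r0\<bar>" 0 e s] near far s(2) by force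
      then have "u \<in> S" "r u = r0 + e \<or> r u = r0 - e" using sub by auto
      then show False using bound [of u] c by auto
    qed
    then show "\<bar>r s - r0\<bar> < \<epsilon>" using e by simp
  qed
qed

section \<open>Accretion flows\<close>

definition accretion_F ::
  "nat \<Rightarrow> (real \<Rightarrow> real) \<Rightarrow> (real \<Rightarrow> real) \<Rightarrow> real \<Rightarrow> real \<Rightarrow> real \<Rightarrow> real \<Rightarrow> real" where
  "accretion_F D f h \<mu> \<omega> r n =
     (h n)\<^sup>2 * (f r + \<mu>\<^sup>2 / (r ^ (2 * (D - 2)) * n\<^sup>2)) * (1 / (1 - \<omega>\<^sup>2 * (f r / r\<^sup>2)))"

definition phase_space :: "real set \<Rightarrow> (real \<Rightarrow> real) \<Rightarrow> real \<Rightarrow> (real \<times> real) set" where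
  "phase_space I f \<omega> = {(r, n). r \<in> I \<and> n > 0 \<and> 1 - \<omega>\<^sup>2 * (f r / r\<^sup>2) > 0}"

text \<open>The logarithmic derivative \<open>d ln h / d ln n\<close>.\<close>

definition sound_speed_sq :: "(real \<Rightarrow> real) \<Rightarrow> real \<Rightarrow> real" where
  "sound_speed_sq h n = deriv (\<lambda>x. ln (h (exp x))) (ln n)"

definition fluid_velocity_sq :: "nat \<Rightarrow> (real \<Rightarrow> real) \<Rightarrow> real \<Rightarrow> real \<Rightarrow> real \<Rightarrow> real" where
  "fluid_velocity_sq D f \<mu> r n = \<mu>\<^sup>2 / (\<mu>\<^sup>2 + f r * r ^ (2 * (D - 2)) * n\<^sup>2)"

definition ideal_photon_gas :: "nat \<Rightarrow> (real \<Rightarrow> real) \<Rightarrow> bool" where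
  "ideal_photon_gas D h \<longleftrightarrow> (\<exists>K>0. \<forall>n>0. h n = K * n powr (1 / (real D - 1)))"

definition physical_flow ::
  "nat \<Rightarrow> real set \<Rightarrow> (real \<Rightarrow> real) \<Rightarrow> (real \<Rightarrow> real) \<Rightarrow> real \<Rightarrow> real \<Rightarrow> real set \<Rightarrow> (real \<Rightarrow> real) \<Rightarrow> bool" where
  "physical_flow D I f h \<mu> \<omega> J n \<longleftrightarrow>
     open J \<and> is_interval J \<and> J \<noteq> {} \<and>
     (\<forall>r\<in>J. n differentiable at r) \<and>
     (\<forall>r\<in>J. (r, n r) \<in> phase_space I f \<omega>) \<and>
     (\<exists>c. \<forall>r\<in>J. accretion_F D f h \<mu> \<omega> r (n r) = c)"

text \<open>Negative where the flow is subsonic, positive where it is supersonic.\<close>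

definition sonic_excess ::
  "nat \<Rightarrow> (real \<Rightarrow> real) \<Rightarrow> (real \<Rightarrow> real) \<Rightarrow> real \<Rightarrow> (real \<Rightarrow> real) \<Rightarrow> real \<Rightarrow> real" where
  "sonic_excess D f h \<mu> n r = fluid_velocity_sq D f \<mu> r (n r) - sound_speed_sq h (n r)"

definition transonic ::
  "nat \<Rightarrow> (real \<Rightarrow> real) \<Rightarrow> (real \<Rightarrow> real) \<Rightarrow> real \<Rightarrow> real set \<Rightarrow> (real \<Rightarrow> real) \<Rightarrow> bool" where
  "transonic D f h \<mu> J n \<longleftrightarrow>
     (\<exists>r1\<in>J. \<exists>r2\<in>J. sonic_excess D f h \<mu> n r1 < 0 \<and> sonic_excess D f h \<mu> n r2 > 0)"

definition sonic_point_of_flow ::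
  "nat \<Rightarrow> (real \<Rightarrow> real) \<Rightarrow> (real \<Rightarrow> real) \<Rightarrow> real \<Rightarrow> real set \<Rightarrow> (real \<Rightarrow> real) \<Rightarrow> real \<Rightarrow> bool" where
  "sonic_point_of_flow D f h \<mu> J n r0 \<longleftrightarrow>
     r0 \<in> J \<and> sonic_excess D f h \<mu> n r0 = 0 \<and>
     ((\<forall>\<^sub>F r in at_left r0. sonic_excess D f h \<mu> n r < 0) \<and>
        (\<forall>\<^sub>F r in at_right r0. sonic_excess D f h \<mu> n r > 0) \<or>
      (\<forall>\<^sub>F r in at_left r0. sonic_excess D f h \<mu> n r > 0) \<and>
        (\<forall>\<^sub>F r in at_right r0. sonic_excess D f h \<mu> n r < 0))"

end

theory Submission
  imports Defs
begin

text \<open>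
  With \<open>x = f / r\<^sup>2\<close>, \<open>N = r\<^bsup>D-1\<^esup> n\<close> and \<open>a = 2 / (D - 1)\<close> one has
  \<open>F = K\<^sup>2 (N\<^bsup>a\<^esup> x + \<mu>\<^sup>2 N\<^bsup>a-2\<^esup>) / (1 - \<omega>\<^sup>2 x)\<close>, so that \<open>r\<close> enters only through \<open>x\<close>.
  At a sonic point \<open>N\<close> is the strict minimiser of the numerator for the given \<open>x\<close>; as \<open>F\<close>
  increases with \<open>x\<close>, constancy of \<open>F\<close> forces \<open>x\<close> to be strictly smaller at all non-sonic
  points of the flow.  A sonic radius is thus a strict local maximum of the null potential, also when
  the second derivative vanishes there.  A null geodesic with the energy and angular momentum of the
  circular orbit, started slightly outside, then solves a separable equation with positive
  right-hand side and escapes.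
\<close>

section \<open>Photon gas flows\<close>

lemma exp_gt_add_one:
  assumes "y \<noteq> (0::real)"
  shows "1 + y < exp y"
proof -
  \<comment> \<open>Equality would read \<open>ln x = x - 1\<close> at \<open>x = exp y\<close>,
    which forces \<open>x = 1\<close> and so \<open>y = 0\<close>.\<close>
  have "exp y \<noteq> 1 + y" using ln_eq_minus_one [of "exp y"] assms by auto
  then show ?thesis using exp_ge_add_one_self [of y] by linarith
qed

text \<open>The weights are chosen so that the tangents at 0 of the two exponential terms,
  \<open>k * (1 + y)\<close> and \<open>1 - k * y\<close>, have opposite slopes; their sum is the
  constant \<open>k + 1\<close>.\<close>

lemma weighted_exp_gt:
  assumes "y \<noteq> (0::real)" and "k > 0"
  shows "k + 1 < k * exp y + exp (- (k * y))"
proof -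
  have "k * (1 + y) < k * exp y" using exp_gt_add_one [OF assms(1)] assms(2) by simp
  moreover have "1 - k * y < exp (- (k * y))" using exp_gt_add_one [of "- (k * y)"] assms by simp
  ultimately show ?thesis by (simp add: algebra_simps)
qed

text \<open>For fixed \<open>x\<close>, the assumption \<open>sonic\<close> says that the derivative
  in \<open>N\<close> vanishes at \<open>N0\<close>. Minimality is global: in the variable
  \<open>y\<close> below and up to a positive factor, the function is the one in
  \<open>weighted_exp_gt\<close> with \<open>k = m - 1\<close>. The application takes
  \<open>m = D - 1\<close>.\<close>

lemma photon_gas_min:
  fixes m x N N0 \<mu> :: real
  assumes m: "m > 1" and N: "N > 0" "N0 > 0" "N \<noteq> N0" and \<mu>: "\<mu> \<noteq> 0"
    and sonic: "x * N0\<^sup>2 = (m - 1) * \<mu>\<^sup>2"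
  shows "N0 powr (2/m) * (x + \<mu>\<^sup>2 / N0\<^sup>2) < N powr (2/m) * (x + \<mu>\<^sup>2 / N\<^sup>2)"
proof -
  \<comment> \<open>This logarithmic variable turns both powers of \<open>N / N0\<close> into
    exponentials: the power \<open>2/m\<close> becomes \<open>exp y\<close> and the square becomes
    \<open>exp (m * y)\<close>.\<close>
  define y where "y = 2 / m * ln (N / N0)"
  have y0: "y \<noteq> 0" using N m by (simp add: y_def)
  have ln: "ln (N / N0) = m * y / 2" using m by (simp add: y_def)
  have ey: "exp y = N powr (2/m) / N0 powr (2/m)"
    using N by (simp add: y_def powr_def ln_div right_diff_distrib exp_diff)
  have "N / N0 = exp (m * y / 2)" using N by (simp flip: ln)
  then have "(N / N0)\<^sup>2 = exp (m * y)"
    by (simp add: power2_eq_square flip: exp_add)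
  then have Nsq: "N\<^sup>2 = N0\<^sup>2 * exp (m * y)" using N by (simp add: power_divide field_simps)
  have x: "x = (m - 1) * \<mu>\<^sup>2 / N0\<^sup>2" using sonic N by (simp add: field_simps)
  have "N0 powr (2/m) * (x + \<mu>\<^sup>2 / N0\<^sup>2) = N0 powr (2/m) * \<mu>\<^sup>2 / N0\<^sup>2 * (m - 1 + 1)"
    unfolding x using N by (simp add: field_simps)
  also have "\<dots> < N0 powr (2/m) * \<mu>\<^sup>2 / N0\<^sup>2 * ((m - 1) * exp y + exp (- ((m - 1) * y)))"
    using weighted_exp_gt [OF y0, of "m - 1"] m N \<mu> by (intro mult_strict_left_mono) auto
  also have "exp (- ((m - 1) * y)) = exp y * inverse (exp (m * y))"
    by (simp add: algebra_simps flip: exp_minus exp_add)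
  also have "N0 powr (2/m) * \<mu>\<^sup>2 / N0\<^sup>2 * ((m - 1) * exp y + exp y * inverse (exp (m * y)))
      = N0 powr (2/m) * exp y * (x + \<mu>\<^sup>2 / N\<^sup>2)"
    unfolding x Nsq using N by (simp add: field_simps)
  also have "N0 powr (2/m) * exp y = N powr (2/m)" using ey N by simp
  finally show ?thesis .
qed

text \<open>The power \<open>2 / (D - 1)\<close> turns \<open>r ^ (D - 1)\<close> into
  \<open>r\<^sup>2\<close>, which is just the factor between \<open>null_potential f r\<close> and
  \<open>f r\<close>. Hence \<open>r ^ (D - 1) * n\<close> absorbs all explicit dependence on the
  radius.\<close>

lemma accretion_F_photon_gas:
  assumes D: "D \<ge> 3" and pos: "r > 0" "n > 0"
    and h: "h n = K * n powr (1 / (real D - 1))"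
  shows "accretion_F D f h \<mu> \<omega> r n =
    K\<^sup>2 * ((r ^ (D - 1) * n) powr (2 / (real D - 1)) *
      (null_potential f r + \<mu>\<^sup>2 / (r ^ (D - 1) * n)\<^sup>2)) / (1 - \<omega>\<^sup>2 * null_potential f r)"
proof -
  have "(r ^ (D - 1)) powr (2 / (real D - 1)) = r powr (real (D - 1) * (2 / (real D - 1)))"
    using pos by (simp add: powr_powr flip: powr_realpow)
  also have "real (D - 1) * (2 / (real D - 1)) = 2" using D by (auto simp: of_nat_diff divide_simps)
  finally have "(r ^ (D - 1) * n) powr (2 / (real D - 1)) = r\<^sup>2 * n powr (2 / (real D - 1))"
    using pos by (simp add: powr_mult)
  moreover have "(h n)\<^sup>2 = K\<^sup>2 * n powr (2 / (real D - 1))"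
    unfolding h by (simp add: power_mult_distrib power2_eq_square flip: powr_add)
  moreover have "(r ^ (D - 1) * n)\<^sup>2 = r\<^sup>2 * (r ^ (2 * (D - 2)) * n\<^sup>2)"
  proof -
    have "D - 1 = Suc (D - 2)" using D by simp
    then show ?thesis by (simp add: power_mult_distrib power_mult power2_eq_square power_even_eq)
  qed
  moreover have "r\<^sup>2 * P * (f r / r\<^sup>2 + \<mu>\<^sup>2 / (r\<^sup>2 * Q)) = P * (f r + \<mu>\<^sup>2 / Q)" for P Q
    using pos by (simp add: distrib_left)
  ultimately show ?thesis
    by (simp only: accretion_F_def null_potential_def) simp
qed

text \<open>For this gas \<open>ln h\<close> is affine in \<open>ln n\<close> with slope
  \<open>1 / (D - 1)\<close>, so the sound speed is constant. The right-hand side keeps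
  \<open>real D - 1 - 1\<close> to match the assumption \<open>sonic\<close> of
  \<open>photon_gas_min\<close> with \<open>m = real D - 1\<close>.\<close>

lemma sonic_excess_photon_gas:
  assumes D: "D \<ge> 3" and pos: "r > 0" "n r > 0" "f r > 0" and \<mu>: "\<mu> \<noteq> 0"
    and h: "ideal_photon_gas D h"
  shows "sonic_excess D f h \<mu> n r = 0 \<longleftrightarrow>
    null_potential f r * (r ^ (D - 1) * n r)\<^sup>2 = (real D - 1 - 1) * \<mu>\<^sup>2"
proof -
  obtain K where K: "K > 0" "\<And>n. n > 0 \<Longrightarrow> h n = K * n powr (1 / (real D - 1))"
    using h by (auto simp: ideal_photon_gas_def)
  have "(\<lambda>x. ln (h (exp x))) = (\<lambda>x. ln K + x / (real D - 1))"
    using K by (auto simp: ln_mult ln_powr)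
  then have s: "sound_speed_sq h (n r) = 1 / (real D - 1)"
    unfolding sound_speed_sq_def using D
    by (auto intro!: DERIV_imp_deriv derivative_eq_intros)
  have "D - 1 = Suc (D - 2)" using D by simp
  then have N: "(r ^ (D - 1) * n r)\<^sup>2 = r\<^sup>2 * (r ^ (2 * (D - 2)) * (n r)\<^sup>2)"
    by (simp add: power_mult_distrib power_mult power2_eq_square power_even_eq)
  define Z where "Z = f r * r ^ (2 * (D - 2)) * (n r)\<^sup>2"
  have Z: "null_potential f r * (r ^ (D - 1) * n r)\<^sup>2 = Z" "Z > 0"
    unfolding N Z_def null_potential_def using pos by auto
  have "\<mu>\<^sup>2 + Z > 0" using Z \<mu> by (simp add: add_pos_pos)
  moreover have "real D - 1 > 0" using D by simp
  moreover have "a / (a + Z) - 1 / k = 0 \<longleftrightarrow> Z = (k - 1) * a" if "a + Z > 0" "k > 0" for a k :: real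
    using that by (simp add: right_minus_eq frac_eq_eq) (auto simp: algebra_simps)
  ultimately show ?thesis
    unfolding sonic_excess_def fluid_velocity_sq_def s Z(1) Z_def [symmetric] by blast
qed

text \<open>The states at \<open>r\<close> and \<open>r0\<close> are compared through a fictitious
  one that combines \<open>N r\<close> with the potential at \<open>r0\<close>. By minimality its
  numerator exceeds the sonic one; since \<open>F\<close> agrees at the two real states, the
  potential must be smaller at \<open>r\<close>. This is a comparison of values, so \<open>r\<close>
  need not be close to \<open>r0\<close>.\<close>

lemma null_potential_lt_sonic:
  assumes D: "D \<ge> 3" and m: "static_spherical_metric I f g" and \<mu>: "\<mu> \<noteq> 0"
    and gas: "ideal_photon_gas D h" and flow: "physical_flow D I f h \<mu> \<omega> J n"
    and r0: "r0 \<in> J" "sonic_excess D f h \<mu> n r0 = 0"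
    and r: "r \<in> J" "sonic_excess D f h \<mu> n r \<noteq> 0"
  shows "null_potential f r < null_potential f r0"
proof -
  let ?x = "null_potential f" and ?m = "real D - 1"
  define N where "N r = r ^ (D - 1) * n r" for r
  define A where "A r = N r powr (2 / ?m)" for r
  obtain K where K: "K > 0" "\<And>n. n > 0 \<Longrightarrow> h n = K * n powr (1 / ?m)"
    using gas by (auto simp: ideal_photon_gas_def)
  obtain c where c: "\<And>r. r \<in> J \<Longrightarrow> accretion_F D f h \<mu> \<omega> r (n r) = c"
    using flow by (auto simp: physical_flow_def)
  have pos: "r > 0" "f r > 0" "n r > 0" "1 - \<omega>\<^sup>2 * ?x r > 0" "N r > 0" "A r > 0" "?x r > 0"
    if "r \<in> J" for r
    using flow m that
    by (auto simp: physical_flow_def phase_space_def static_spherical_metric_def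
        null_potential_def N_def A_def)
  have F: "A r * (?x r + \<mu>\<^sup>2 / (N r)\<^sup>2) = c / K\<^sup>2 * (1 - \<omega>\<^sup>2 * ?x r)" if "r \<in> J" for r
  proof -
    have "c = K\<^sup>2 * (A r * (?x r + \<mu>\<^sup>2 / (N r)\<^sup>2)) / (1 - \<omega>\<^sup>2 * ?x r)"
      unfolding c [OF that, symmetric] A_def N_def
      using pos [OF that] D by (intro accretion_F_photon_gas K) auto
    then show ?thesis using pos(4) [OF that] K(1) by (simp add: field_simps)
  qed
  have sonic: "sonic_excess D f h \<mu> n r = 0 \<longleftrightarrow> ?x r * (N r)\<^sup>2 = (?m - 1) * \<mu>\<^sup>2" if "r \<in> J" for r
    unfolding N_def using pos [OF that] D \<mu> gas by (intro sonic_excess_photon_gas) auto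
  define C where "C = c / K\<^sup>2"
  have "C * (1 - \<omega>\<^sup>2 * ?x r) > 0"
    unfolding C_def F [OF r(1), symmetric] using pos [OF r(1)]
    by (intro mult_pos_pos add_pos_nonneg) auto
  then have "C > 0" using pos(4) [OF r(1)] by (simp add: zero_less_mult_iff)
  then have M: "A r + C * \<omega>\<^sup>2 > 0" using pos [OF r(1)] by (intro add_pos_nonneg) auto
  have Fr: "A r * (?x r + \<mu>\<^sup>2 / (N r)\<^sup>2) = C * (1 - \<omega>\<^sup>2 * ?x r)"
    and F0: "A r0 * (?x r0 + \<mu>\<^sup>2 / (N r0)\<^sup>2) = C * (1 - \<omega>\<^sup>2 * ?x r0)"
    using F r r0 by (auto simp: C_def)
  \<comment> \<open>For equal \<open>N\<close> both radii satisfy the same linear equation in the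
    potential, with nonzero coefficient \<open>A r + C * \<omega>\<^sup>2\<close>. The potentials
    then agree, and \<open>r\<close> would be sonic too.\<close>
  have "N r \<noteq> N r0"
  proof
    assume e: "N r = N r0"
    then have "A r = A r0" by (simp add: A_def)
    then have "(A r + C * \<omega>\<^sup>2) * (?x r0 - ?x r) = 0" using Fr F0 e by (simp add: algebra_simps)
    then have "?x r = ?x r0" using M by simp
    then show False using e r r0 sonic by simp
  qed
  then have "A r0 * (?x r0 + \<mu>\<^sup>2 / (N r0)\<^sup>2) < A r * (?x r0 + \<mu>\<^sup>2 / (N r)\<^sup>2)"
    unfolding A_def using D pos r r0 \<mu> sonic by (intro photon_gas_min) auto
  then have "(A r + C * \<omega>\<^sup>2) * (?x r0 - ?x r) > 0"
    using Fr F0 by (simp add: algebra_simps)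
  then show ?thesis using M by (simp add: zero_less_mult_iff)
qed

section \<open>Instability of circular null orbits\<close>

text \<open>The solution of \<open>r' = G r\<close> is the inverse of the travel time, the integral
  of \<open>1 / G\<close> from \<open>p\<close>. The last clause, that all radii from
  \<open>p\<close> up to \<open>b\<close> are reached at nonnegative parameters, is what later
  defeats stability.\<close>

lemma separable_ode_solution:
  fixes G :: "real \<Rightarrow> real"
  assumes ab: "a < p" "p < b" and cont: "continuous_on {a..b} G"
    and G: "\<And>u. u \<in> {a..b} \<Longrightarrow> G u > 0"
  shows "\<exists>S r. open S \<and> is_interval S \<and> 0 \<in> S \<and> r 0 = p \<and>
    (\<forall>s\<in>S. r s \<in> {a<..<b} \<and> (r has_field_derivative G (r s)) (at s)) \<and>
    (\<forall>u. p \<le> u \<and> u < b \<longrightarrow> (\<exists>s\<in>S. 0 \<le> s \<and> r s = u))"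
proof -
  have "continuous_on {a..b} (\<lambda>u. inverse (G u))"
    using cont G by (intro continuous_intros) force+
  then obtain B where B: "\<And>u. u \<in> {a..b} \<Longrightarrow>
      (B has_vector_derivative inverse (G u)) (at u within {a..b})"
    using antiderivative_continuous by blast
  \<comment> \<open>Travel time from \<open>p\<close> to \<open>u\<close>, normalised so that
    parameter 0 corresponds to radius \<open>p\<close>.\<close>
  define A where "A u = B u - B p" for u
  have A: "(A has_field_derivative inverse (G u)) (at u within {a..b})" if "u \<in> {a..b}" for u
    unfolding A_def has_real_derivative_iff_has_vector_derivative
    using B [OF that] by (auto intro!: derivative_eq_intros)
  have Aat: "(A has_field_derivative inverse (G u)) (at u)" if "a < u" "u < b" for u
    using A [of u] that by (simp add: at_within_Icc_at)
  have contA: "continuous_on {a..b} A"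
    using DERIV_continuous [OF A] by (simp add: continuous_on_eq_continuous_within)
  have mono: "A u < A v" if "a \<le> u" "u < v" "v \<le> b" for u v
  proof (rule DERIV_pos_imp_increasing_open [OF that(2)])
    show "\<exists>y. (A has_real_derivative y) (at w) \<and> 0 < y" if "u < w" "w < v" for w
      using Aat [of w] G [of w] that \<open>a \<le> u\<close> \<open>v \<le> b\<close> by fastforce
    show "continuous_on {u..v} A" using contA that by (auto elim: continuous_on_subset)
  qed
  then have inj: "inj_on A {a..b}" by (intro linorder_inj_onI) (auto, fastforce)
  define r where "r = inv_into {a..b} A"
  have rA: "r (A u) = u" if "u \<in> {a..b}" for u
    unfolding r_def using inj that by (rule inv_into_f_f)
  have im: "{A a..A b} \<subseteq> A ` {a..b}"
  proof
    fix s assume "s \<in> {A a..A b}"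
    then obtain u where "a \<le> u" "u \<le> b" "A u = s"
      using IVT' [of A a s b] contA ab by auto
    then show "s \<in> A ` {a..b}" by auto
  qed
  have Ar: "A (r s) = s" "r s \<in> {a<..<b}" if "s \<in> {A a<..<A b}" for s
  proof -
    have "s \<in> A ` {a..b}" using im that by auto
    then have *: "A (r s) = s" "r s \<in> {a..b}"
      unfolding r_def by (rule f_inv_into_f, rule inv_into_into)
    then show "A (r s) = s" by simp
    have "r s \<noteq> a" "r s \<noteq> b" using * that by auto
    with * show "r s \<in> {a<..<b}" by auto
  qed
  \<comment> \<open>Compactness of the interval makes the inverse of the continuous injection
    \<open>A\<close> continuous, as the inverse function rule requires.\<close>
  have "continuous_on (A ` {a..b}) r"
    using contA rA by (intro continuous_on_inv) auto
  then have "continuous_on {A a<..<A b} r"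
    by (rule continuous_on_subset) (use im in auto)
  then have cr: "isCont r s" if "s \<in> {A a<..<A b}" for s
    using that by (simp add: continuous_on_eq_continuous_at)
  have der: "(r has_field_derivative G (r s)) (at s)" if "s \<in> {A a<..<A b}" for s
  proof -
    have "(r has_field_derivative inverse (inverse (G (r s)))) (at s)"
    proof (rule DERIV_inverse_function)
      show "(A has_field_derivative inverse (G (r s))) (at (r s))"
        using Aat Ar(2) [OF that] by auto
      show "inverse (G (r s)) \<noteq> 0" using G [of "r s"] Ar(2) [OF that] by auto
      show "A a < s" "s < A b" using that by auto
      show "A (r y) = y" if "A a < y" "y < A b" for y using that Ar by auto
      show "isCont r s" by (rule cr [OF that])
    qed
    then show ?thesis by simp
  qed
  have A0: "A p = 0" by (simp add: A_def)
  show ?thesis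
  proof (intro exI [of _ "{A a<..<A b}"] exI [of _ r] conjI ballI allI impI)
    show "open {A a<..<A b}" by simp
    show "is_interval {A a<..<A b}" by simp
    show "0 \<in> {A a<..<A b}" using mono [of a p] mono [of p b] A0 ab by simp
    show "r 0 = p" using rA [of p] A0 ab by simp
    show "r s \<in> {a<..<b}" if "s \<in> {A a<..<A b}" for s using Ar that by auto
    show "(r has_field_derivative G (r s)) (at s)" if "s \<in> {A a<..<A b}" for s
      by (rule der [OF that])
    show "\<exists>s\<in>{A a<..<A b}. 0 \<le> s \<and> r s = u" if "p \<le> u \<and> u < b" for u
    proof (intro bexI [of _ "A u"] conjI)
      show "0 \<le> A u" using mono [of p u] A0 that ab by (cases "p = u") auto
      show "r (A u) = u" using rA that ab by auto
      show "A u \<in> {A a<..<A b}" using mono [of a u] mono [of u b] that ab by auto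
    qed
  qed
qed

text \<open>With energy \<open>E\<close> and angular momentum \<open>L\<close> prescribed, the
  geodesic obeys first-order equations for \<open>t\<close>, \<open>r\<close> and \<phi>. The
  assumption \<open>turn\<close> excludes turning points, so the radial one is separable with
  positive right-hand side; differentiating the three equations gives the second-order ones.\<close>

lemma null_geodesic_outgoing:
  assumes m: "static_spherical_metric I f g" and ab: "a < p" "p < b" "{a..b} \<subseteq> I"
    and E: "E \<noteq> 0" and turn: "\<And>u. u \<in> {a..b} \<Longrightarrow> L\<^sup>2 * null_potential f u < E\<^sup>2"
  shows "\<exists>S t r \<phi>. null_geodesic I f g S t r \<phi> \<and> 0 \<in> S \<and> r 0 = p \<and>
    deriv r 0 = sqrt ((E\<^sup>2 - L\<^sup>2 * null_potential f p) / (f p * g p)) \<and>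
    deriv t 0 = E / f p \<and> deriv \<phi> 0 = L / p\<^sup>2 \<and>
    (\<forall>u. p \<le> u \<and> u < b \<longrightarrow> (\<exists>s\<in>S. 0 \<le> s \<and> r s = u))"
proof -
  have pos: "u > 0" "f u > 0" "g u > 0" if "u \<in> I" for u
    using m that by (auto simp: static_spherical_metric_def)
  have fd: "(f has_field_derivative deriv f u) (at u)"
       "(g has_field_derivative deriv g u) (at u)" if "u \<in> I" for u
    using m that by (auto simp: static_spherical_metric_def DERIV_deriv_iff_real_differentiable)
  \<comment> \<open>The squared radial velocity that the null condition dictates at radius
    \<open>u\<close>; \<open>W1\<close> below is its derivative, and the radial acceleration is
    \<open>W1 / 2\<close>.\<close>
  define W where "W u = (E\<^sup>2 - L\<^sup>2 * (f u / u\<^sup>2)) / (f u * g u)" for u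
  define W1 where "W1 u = (- (L\<^sup>2 * ((deriv f u * u\<^sup>2 - f u * (2 * u)) / (u\<^sup>2 * u\<^sup>2))) * (f u * g u)
      - (E\<^sup>2 - L\<^sup>2 * (f u / u\<^sup>2)) * (deriv f u * g u + deriv g u * f u)) / (f u * g u * (f u * g u))" for u
  define G where "G u = sqrt (W u)" for u
  have Wpos: "W u > 0" if "u \<in> {a..b}" for u
    using turn [OF that] pos [of u] that ab by (auto simp: W_def null_potential_def)
  then have Gpos: "G u > 0" if "u \<in> {a..b}" for u using that by (simp add: G_def)
  have Wd: "(W has_field_derivative W1 u) (at u)" if "u \<in> I" for u
    unfolding W_def [abs_def] W1_def
    using pos [OF that] fd [OF that] by (auto intro!: derivative_eq_intros simp: algebra_simps)
  have Gd: "(G has_field_derivative W1 u / (2 * G u)) (at u)" if "u \<in> {a..b}" for u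
    unfolding G_def [abs_def]
    using Wd [of u] Wpos [OF that] that ab
    by (auto intro!: derivative_eq_intros simp: field_simps)
  have contI: "continuous_on {a..b} f" "continuous_on {a..b} G"
    using fd(1) ab(3) Gd by (blast intro: continuous_at_imp_continuous_on DERIV_isCont)+
  obtain S r where S: "open S" "is_interval S" "0 \<in> S" and r0: "r 0 = p"
    and r: "\<And>s. s \<in> S \<Longrightarrow> r s \<in> {a<..<b}"
      "\<And>s. s \<in> S \<Longrightarrow> (r has_field_derivative G (r s)) (at s)"
    and reach: "\<forall>u. p \<le> u \<and> u < b \<longrightarrow> (\<exists>s\<in>S. 0 \<le> s \<and> r s = u)"
    using separable_ode_solution [OF ab(1,2) contI(2) Gpos] by auto
  \<comment> \<open>A rate \<open>k\<close> depending only on the radius is integrated with the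
    radius as variable: if \<open>Q\<close> has derivative \<open>k / G\<close>, then
    \<open>Q (r s)\<close> has derivative \<open>k (r s)\<close>. This yields \<open>t\<close> and
    \<phi>.\<close>
  have lift: "\<exists>q. \<forall>s\<in>S. (q has_field_derivative k (r s)) (at s)"
    if k: "continuous_on {a..b} k" for k
  proof -
    have "continuous_on {a..b} (\<lambda>u. k u / G u)"
      using k contI Gpos by (intro continuous_intros) force+
    then obtain Q where Q: "\<And>u. u \<in> {a..b} \<Longrightarrow>
        (Q has_vector_derivative k u / G u) (at u within {a..b})"
      using antiderivative_continuous by blast
    have "((\<lambda>s. Q (r s)) has_field_derivative k (r s)) (at s)" if "s \<in> S" for s
    proof -
      have "(Q has_field_derivative k (r s) / G (r s)) (at (r s))"
        using Q [of "r s"] r(1) [OF that]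
        by (simp add: at_within_Icc_at has_real_derivative_iff_has_vector_derivative)
      from DERIV_chain2 [OF this r(2) [OF that]] show ?thesis
        using Gpos [of "r s"] r(1) [OF that] by simp
    qed
    then show ?thesis by auto
  qed
  have "continuous_on {a..b} (\<lambda>u. E / f u)"
    using contI pos(2) ab by (intro continuous_intros) force+
  from lift [OF this] obtain t where t: "\<And>s. s \<in> S \<Longrightarrow> (t has_field_derivative E / f (r s)) (at s)"
    by auto
  have "continuous_on {a..b} (\<lambda>u. L / u\<^sup>2)"
    using pos(1) ab by (intro continuous_intros) force+
  from lift [OF this] obtain \<phi> where \<phi>: "\<And>s. s \<in> S \<Longrightarrow> (\<phi> has_field_derivative L / (r s)\<^sup>2) (at s)"
    by auto
  have rI: "r s \<in> I" "r s \<in> {a..b}" if "s \<in> S" for s using r(1) [OF that] ab by auto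
  have d1: "deriv r s = G (r s)" "deriv t s = E / f (r s)" "deriv \<phi> s = L / (r s)\<^sup>2"
    if "s \<in> S" for s
    using r(2) t \<phi> that by (auto intro: DERIV_imp_deriv)
  have d2: "(deriv r has_field_derivative W1 (r s) / 2) (at s)"
      "(deriv t has_field_derivative - (E * deriv f (r s) * G (r s)) / (f (r s))\<^sup>2) (at s)"
      "(deriv \<phi> has_field_derivative - (2 * L * G (r s)) / (r s) ^ 3) (at s)"
    if s: "s \<in> S" for s
  proof -
    note P = pos [OF rI(1) [OF s]] Gpos [OF rI(2) [OF s]]
    \<comment> \<open>The formulas \<open>d1\<close> are known on \<open>S\<close> only; openness of
      \<open>S\<close> allows differentiating them.\<close>
    have ev: "\<forall>\<^sub>F s in nhds s. s \<in> S" using S s by (simp add: eventually_nhds_in_open)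
    have "((\<lambda>s. G (r s)) has_field_derivative W1 (r s) / 2) (at s)"
      using DERIV_chain2 [OF Gd [OF rI(2) [OF s]] r(2) [OF s]] P by simp
    then show "(deriv r has_field_derivative W1 (r s) / 2) (at s)"
      by (subst DERIV_cong_ev [OF refl eventually_mono [OF ev] refl]) (auto simp: d1)
    have "((\<lambda>s. f (r s)) has_field_derivative deriv f (r s) * G (r s)) (at s)"
      using DERIV_chain2 [OF fd(1) [OF rI(1) [OF s]] r(2) [OF s]] .
    then have "((\<lambda>s. E / f (r s)) has_field_derivative - (E * deriv f (r s) * G (r s)) / (f (r s))\<^sup>2) (at s)"
      using P by (auto intro!: derivative_eq_intros simp: power2_eq_square)
    then show "(deriv t has_field_derivative - (E * deriv f (r s) * G (r s)) / (f (r s))\<^sup>2) (at s)"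
      by (subst DERIV_cong_ev [OF refl eventually_mono [OF ev] refl]) (auto simp: d1)
    have "((\<lambda>s. L / (r s)\<^sup>2) has_field_derivative - (2 * L * G (r s)) / (r s) ^ 3) (at s)"
      using P r(2) [OF s]
      by (auto intro!: derivative_eq_intros simp: power2_eq_square power3_eq_cube field_simps)
    then show "(deriv \<phi> has_field_derivative - (2 * L * G (r s)) / (r s) ^ 3) (at s)"
      by (subst DERIV_cong_ev [OF refl eventually_mono [OF ev] refl]) (auto simp: d1)
  qed
  have "null_geodesic I f g S t r \<phi>"
    unfolding null_geodesic_def
  proof (intro conjI ballI)
    show "open S" "is_interval S" by fact+
    fix s assume s: "s \<in> S"
    note P = pos [OF rI(1) [OF s]] Gpos [OF rI(2) [OF s]]
    note dd = d2 [OF s, THEN DERIV_imp_deriv]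
    have G2: "(G (r s))\<^sup>2 = W (r s)" using Wpos [OF rI(2) [OF s]] by (simp add: G_def)
    show "r s \<in> I" by (rule rI [OF s])
    show "t differentiable at s" "r differentiable at s" "\<phi> differentiable at s"
      "deriv t differentiable at s" "deriv r differentiable at s" "deriv \<phi> differentiable at s"
      using t [OF s] r(2) [OF s] \<phi> [OF s] d2 [OF s] real_differentiable_def by blast+
    show "deriv t s \<noteq> 0" using E P by (simp add: d1 [OF s])
    show "- f (r s) * (deriv t s)\<^sup>2 + g (r s) * (deriv r s)\<^sup>2 + (r s)\<^sup>2 * (deriv \<phi> s)\<^sup>2 = 0"
      unfolding d1 [OF s] G2 W_def using P
      by (simp add: field_simps power2_eq_square)
    show "f (r s) * deriv (deriv t) s + deriv f (r s) * deriv r s * deriv t s = 0"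
      unfolding d1 [OF s] dd using P by (simp add: field_simps power2_eq_square)
    show "g (r s) * deriv (deriv r) s + deriv g (r s) / 2 * (deriv r s)\<^sup>2
          + deriv f (r s) / 2 * (deriv t s)\<^sup>2 - r s * (deriv \<phi> s)\<^sup>2 = 0"
      unfolding d1 [OF s] dd G2 W_def W1_def using P
      by (simp add: field_simps power2_eq_square)
    show "r s * deriv (deriv \<phi>) s + 2 * deriv r s * deriv \<phi> s = 0"
      unfolding d1 [OF s] dd using P by (simp add: field_simps power2_eq_square power3_eq_cube)
  qed
  moreover have "deriv r 0 = sqrt ((E\<^sup>2 - L\<^sup>2 * null_potential f p) / (f p * g p))"
    using d1(1) [OF S(3)] r0 by (simp add: G_def W_def null_potential_def)
  moreover have "deriv t 0 = E / f p" "deriv \<phi> 0 = L / p\<^sup>2"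
    using d1(2,3) [OF S(3)] r0 by simp_all
  ultimately show ?thesis using S(3) r0 reach by blast
qed

text \<open>The perturbed geodesics share \<open>E\<close> and \<open>L\<close> with the circular
  orbit and start outward at \<open>p > r0\<close>. Just outside \<open>r0\<close> the potential is
  below its value at \<open>r0\<close>, so they meet no turning point there, while their initial
  data tend to those of the orbit as \<open>p\<close> tends to \<open>r0\<close>.\<close>

lemma not_stable_circular_orbit:
  assumes m: "static_spherical_metric I f g" and r0: "r0 \<in> I"
    and orb: "circular_null_orbit I f g r0 t0 \<phi>0"
    and max: "\<forall>\<^sub>F r in at_right r0. null_potential f r < null_potential f r0"
  shows "\<not> stable_circular_orbit I f g r0 t0 \<phi>0"
proof
  assume st: "stable_circular_orbit I f g r0 t0 \<phi>0"
  let ?x = "null_potential f"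
  have I: "open I" and pos: "\<And>r. r \<in> I \<Longrightarrow> r > 0 \<and> f r > 0 \<and> g r > 0"
    using m by (auto simp: static_spherical_metric_def)
  have iso: "isCont f r0" "isCont g r0"
    using m r0 by (auto simp: static_spherical_metric_def intro: differentiable_imp_continuous_within)
  define E where "E = f r0 * deriv t0 0"
  define L where "L = r0\<^sup>2 * deriv \<phi>0 0"
  have t0: "deriv t0 0 \<noteq> 0" and nul: "f r0 * (deriv t0 0)\<^sup>2 = r0\<^sup>2 * (deriv \<phi>0 0)\<^sup>2"
    using orb by (auto simp: null_geodesic_def circular_null_orbit_def)
  have E: "E \<noteq> 0" using t0 pos [OF r0] by (simp add: E_def)
  have "E\<^sup>2 = f r0 * (f r0 * (deriv t0 0)\<^sup>2)" by (simp add: E_def power2_eq_square)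
  also have "\<dots> = L\<^sup>2 * ?x r0"
    unfolding nul using pos [OF r0] by (simp add: L_def null_potential_def power2_eq_square)
  finally have EL: "E\<^sup>2 = L\<^sup>2 * ?x r0" .
  then have "L \<noteq> 0" using E by auto
  obtain b where b: "b > r0" "\<And>r. r0 < r \<Longrightarrow> r < b \<Longrightarrow> ?x r < ?x r0"
    using max by (auto simp: eventually_at_right [of r0 "r0 + 1"])
  obtain k where k: "k > 0" "cball r0 k \<subseteq> I"
    using I r0 open_contains_cball by blast
  define e where "e = min k (b - r0) / 2"
  have e: "e > 0" "e < k" "r0 + e < b"
    using k b by (auto simp: e_def min_def field_simps)
  have inI: "r \<in> I" if "\<bar>r - r0\<bar> \<le> e" for r
    using k e that by (auto simp: dist_real_def abs_minus_commute subset_iff)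
  \<comment> \<open>Stability is tested with tolerance \<open>e / 2\<close>, so that the violating
    radius \<open>r0 + e / 2\<close> lies strictly below the end \<open>r0 + e\<close> of the radii
    reached.\<close>
  obtain \<delta> where \<delta>: "\<delta> > 0" and bd: "\<And>S t r \<phi> s.
        null_geodesic I f g S t r \<phi> \<Longrightarrow> 0 \<in> S \<Longrightarrow>
        \<bar>r 0 - r0\<bar> < \<delta> \<Longrightarrow> \<bar>deriv r 0\<bar> < \<delta> \<Longrightarrow>
        \<bar>deriv t 0 - deriv t0 0\<bar> < \<delta> \<Longrightarrow> \<bar>deriv \<phi> 0 - deriv \<phi>0 0\<bar> < \<delta> \<Longrightarrow>
        s \<in> S \<Longrightarrow> 0 \<le> s \<Longrightarrow> \<bar>r s - r0\<bar> < e / 2"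
    using st e(1) unfolding stable_circular_orbit_def by (metis half_gt_zero)
  \<comment> \<open>Initial radial velocity at \<open>p\<close>; it tends to 0 at \<open>r0\<close>
    because of \<open>EL\<close>.\<close>
  define v where "v p = sqrt ((E\<^sup>2 - L\<^sup>2 * ?x p) / (f p * g p))" for p
  have tend: "(f \<longlongrightarrow> f r0) (at_right r0)" "(g \<longlongrightarrow> g r0) (at_right r0)"
    using iso by (auto simp: isCont_def intro: tendsto_mono [OF at_le])
  have "(v \<longlongrightarrow> sqrt ((E\<^sup>2 - L\<^sup>2 * ?x r0) / (f r0 * g r0))) (at_right r0)"
    unfolding v_def [abs_def] null_potential_def
    using pos [OF r0] by (intro tendsto_intros tend) auto
  then have v: "(v \<longlongrightarrow> 0) (at_right r0)" using EL by simp
  have "((\<lambda>p. E / f p) \<longlongrightarrow> E / f r0) (at_right r0)"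
    using pos [OF r0] by (intro tendsto_intros tend) auto
  then have t: "((\<lambda>p. E / f p) \<longlongrightarrow> deriv t0 0) (at_right r0)"
    using pos [OF r0] by (simp add: E_def)
  have "((\<lambda>p. L / p\<^sup>2) \<longlongrightarrow> L / r0\<^sup>2) (at_right r0)"
    using pos [OF r0] by (intro tendsto_intros) auto
  then have \<phi>: "((\<lambda>p. L / p\<^sup>2) \<longlongrightarrow> deriv \<phi>0 0) (at_right r0)"
    using pos [OF r0] by (simp add: L_def)
  have id: "((\<lambda>p. p) \<longlongrightarrow> r0) (at_right r0)" by (rule tendsto_ident_at)
  have "\<forall>\<^sub>F p in at_right r0. dist (v p) 0 < \<delta> \<and> dist (E / f p) (deriv t0 0) < \<delta> \<and>
      dist (L / p\<^sup>2) (deriv \<phi>0 0) < \<delta> \<and> dist p r0 < \<delta> \<and> r0 < p \<and> p < r0 + e / 2"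
    using v t \<phi> id \<delta> e
    by (intro eventually_conj tendstoD eventually_at_rightI [of r0 "r0 + e / 2"]) auto
  from eventually_happens [OF this] obtain p where p: "\<bar>v p\<bar> < \<delta>" "\<bar>E / f p - deriv t0 0\<bar> < \<delta>"
      "\<bar>L / p\<^sup>2 - deriv \<phi>0 0\<bar> < \<delta>" "\<bar>p - r0\<bar> < \<delta>" "r0 < p" "p < r0 + e / 2"
    by (auto simp: dist_real_def)
  \<comment> \<open>The left end is the midpoint of \<open>r0\<close> and \<open>p\<close>: the
    start \<open>p\<close> must be interior, but the strict inequality fails at \<open>r0\<close>
    itself.\<close>
  have turn: "L\<^sup>2 * ?x u < E\<^sup>2" if "u \<in> {(r0 + p) / 2..r0 + e}" for u
    unfolding EL using b(2) [of u] \<open>L \<noteq> 0\<close> that e p by auto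
  have "(r0 + p) / 2 < p" "p < r0 + e" "{(r0 + p) / 2..r0 + e} \<subseteq> I"
    using p e by (auto intro!: inI)
  from null_geodesic_outgoing [OF m this E turn]
  obtain S t r \<phi> where geo: "null_geodesic I f g S t r \<phi>" "0 \<in> S" "r 0 = p" "deriv r 0 = v p"
    "deriv t 0 = E / f p" "deriv \<phi> 0 = L / p\<^sup>2"
    and reach: "\<forall>u. p \<le> u \<and> u < r0 + e \<longrightarrow> (\<exists>s\<in>S. 0 \<le> s \<and> r s = u)"
    unfolding v_def by blast
  obtain s where "s \<in> S" "0 \<le> s" "r s = r0 + e / 2"
    using reach [rule_format, of "r0 + e / 2"] p e by auto
  then show False using bd [OF geo(1,2), of s] geo p e by simp
qed

text \<open>Instability is concluded for the geodesics themselves, which also covers a degenerate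
  critical point of the potential; the further conjuncts link it to the derivative
  criterion.\<close>

theorem theorem2:
  fixes D :: nat and I J :: "real set" and f g h n :: "real \<Rightarrow> real" and \<mu> \<omega> r0 :: real
  assumes "D \<ge> 3"
    and "static_spherical_metric I f g"
    and "\<mu> \<noteq> 0"
    and "ideal_photon_gas D h"
    and "physical_flow D I f h \<mu> \<omega> J n"
    and "transonic D f h \<mu> J n"
    and "sonic_point_of_flow D f h \<mu> J n r0"
  shows "unstable_photon_sphere I f g r0
    \<and> deriv (null_potential f) r0 = 0
    \<and> (deriv (deriv (null_potential f)) r0 \<noteq> 0 \<longrightarrow> deriv (deriv (null_potential f)) r0 < 0)"
proof -
  let ?x = "null_potential f" and ?s = "sonic_excess D f h \<mu> n"
  have J: "open J" "r0 \<in> J" "?s r0 = 0" and "J \<subseteq> I"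
    using assms(5,7) by (auto simp: physical_flow_def sonic_point_of_flow_def phase_space_def)
  then have r0: "r0 \<in> I" by auto
  have lt: "?x r < ?x r0" if "r \<in> J" "?s r \<noteq> 0" for r
    using null_potential_lt_sonic assms(1-5) J that by blast
  \<comment> \<open>The strict signs on both sides isolate the sonic radius, so the maximum of the
    potential is strict.\<close>
  have "\<forall>\<^sub>F r in at r0. ?s r \<noteq> 0"
    using assms(7) unfolding sonic_point_of_flow_def eventually_at_split
    by (auto elim!: eventually_mono)
  moreover have "\<forall>\<^sub>F r in at r0. r \<in> J"
    using J by (simp add: eventually_at_in_open')
  ultimately have max: "\<forall>\<^sub>F r in at r0. ?x r < ?x r0"
    by eventually_elim (rule lt)
  then obtain d where d: "d > 0" "\<And>r. r \<noteq> r0 \<Longrightarrow> dist r r0 < d \<Longrightarrow> ?x r < ?x r0"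
    by (auto simp: eventually_at)
  have pos: "r0 > 0" and "f differentiable at r0"
    using assms(2) r0 by (auto simp: static_spherical_metric_def)
  then have "(f has_field_derivative deriv f r0) (at r0)"
    by (simp add: DERIV_deriv_iff_real_differentiable)
  then have "?x field_differentiable at r0"
    unfolding null_potential_def [abs_def] field_differentiable_def
    using pos by (intro exI) (auto intro!: derivative_eq_intros)
  then have "(?x has_field_derivative deriv ?x r0) (at r0)"
    by (rule field_differentiable_derivI)
  then have d0: "deriv ?x r0 = 0"
  proof (rule DERIV_local_max [OF _ d(1)], intro allI impI)
    fix r assume "\<bar>r0 - r\<bar> < d"
    then show "?x r \<le> ?x r0"
      using d(2) [of r] by (cases "r = r0") (auto simp: dist_real_def abs_minus_commute)
  qed
  then have ps: "photon_sphere I f g r0" using photon_sphere_iff [OF assms(2) r0] by simp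
  have unstable: "\<not> stable_circular_orbit I f g r0 t \<phi>" if "circular_null_orbit I f g r0 t \<phi>" for t \<phi>
    using not_stable_circular_orbit [OF assms(2) r0 that] max by (simp add: eventually_at_split)
  \<comment> \<open>A positive second derivative would make every circular orbit at
    \<open>r0\<close> stable, and the photon sphere provides at least one such orbit.\<close>
  have "\<not> deriv (deriv ?x) r0 > 0"
    using stable_circular_orbit_if [OF assms(2) r0] ps unstable
    unfolding photon_sphere_def by blast
  then show ?thesis using ps unstable d0 by (auto simp: unstable_photon_sphere_def)
qed

end
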